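(* If $G$ and $H$ are connected graphs of order at least $2$, then $\mathrm{gp}_{\mathrm t}(G\,\square\,H)=0$.
   Context: All graphs are finite and simple. The Cartesian product $G\,\square\,H$ has vertex set $V(G)\times V(H)$, with $(g,h)$ and $(g',h')$ adjacent if either $gg'\in E(G)$ and $h=h'$, or $g=g'$ and $hh'\in E(H)$. For a graph $G$ and $X\subseteq V(G)$, vertices $u,v\in V(G)$ are $X$-positionable if for every shortest $u,v$-path $P$ in $G$ we have $V(P)\cap X\subseteq\{u,v\}$. A set $X\subseteq V(G)$ is a total general position set if every two vertices $u,v\in V(G)$ are $X$-positionable. The total general position number $\mathrm{gp}_{\mathrm t}(G)$ is the cardinality of a largest total general position set of $G$ (it is $0$ if only the empty set has the property). *)

theory Defs
  imports
    "Graph_Theory.Pair_Digraph"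
    "Graph_Theory.Digraph_Component"
    "Graph_Theory.Vertex_Walk"
begin

text \<open>
  A finite simple graph is a \<^locale>\<open>pair_graph\<close>: a finite vertex set with a symmetric,
  irreflexive set of arcs, each edge being represented by its two orientations.
\<close>

definition cart_prod ::
    "'a pair_pre_digraph \<Rightarrow> 'b pair_pre_digraph \<Rightarrow> ('a \<times> 'b) pair_pre_digraph"
    (infixr \<open>\<box>\<close> 70) where
  "G \<box> H =
    \<lparr> pverts = pverts G \<times> pverts H,
      parcs = {((g, h), (g', h')) | g h g' h'.
        (g, h) \<in> pverts G \<times> pverts H \<and> (g', h') \<in> pverts G \<times> pverts H \<and>
        ((g, g') \<in> parcs G \<and> h = h' \<or> g = g' \<and> (h, h') \<in> parcs H)} \<rparr>"

definition path_betw :: "'a pair_pre_digraph \<Rightarrow> 'a \<Rightarrow> 'a vwalk \<Rightarrow> 'a \<Rightarrow> bool" where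
  "path_betw G u p v \<longleftrightarrow> vpath p (with_proj G) \<and> hd p = u \<and> last p = v"

definition shortest_path :: "'a pair_pre_digraph \<Rightarrow> 'a \<Rightarrow> 'a vwalk \<Rightarrow> 'a \<Rightarrow> bool" where
  "shortest_path G u p v \<longleftrightarrow>
    path_betw G u p v \<and> (\<forall>q. path_betw G u q v \<longrightarrow> vwalk_length p \<le> vwalk_length q)"

definition positionable :: "'a pair_pre_digraph \<Rightarrow> 'a set \<Rightarrow> 'a \<Rightarrow> 'a \<Rightarrow> bool" where
  "positionable G X u v \<longleftrightarrow> (\<forall>p. shortest_path G u p v \<longrightarrow> set p \<inter> X \<subseteq> {u, v})"

definition total_gp_set :: "'a pair_pre_digraph \<Rightarrow> 'a set \<Rightarrow> bool" where
  "total_gp_set G X \<longleftrightarrow>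
    X \<subseteq> pverts G \<and> (\<forall>u \<in> pverts G. \<forall>v \<in> pverts G. positionable G X u v)"

text \<open>
  For a graph with finite vertex set the maximum below ranges over a finite set, which is
  nonempty because the empty set is always a total general position set.
\<close>

definition gp_t :: "'a pair_pre_digraph \<Rightarrow> nat" where
  "gp_t G = Max (card ` {X. total_gp_set G X})"

lemma pair_graph_cart_prod:
  assumes "pair_graph G" "pair_graph H"
  shows "pair_graph (G \<box> H)"
proof -
  interpret G: pair_graph G by fact
  interpret H: pair_graph H by fact
  have "parcs (G \<box> H) \<subseteq> (pverts G \<times> pverts H) \<times> (pverts G \<times> pverts H)"
    by (auto simp: cart_prod_def)
  then have "finite (parcs (G \<box> H))"
    by (rule finite_subset) (simp add: G.pair_finite_verts H.pair_finite_verts)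
  moreover have "sym (parcs (G \<box> H))"
    by (auto simp: cart_prod_def sym_def intro: G.arcs_symmetric H.arcs_symmetric)
  ultimately show ?thesis
    by unfold_locales
      (auto simp: cart_prod_def symmetric_def G.pair_finite_verts H.pair_finite_verts
        dest: G.no_loops' H.no_loops')
qed

lemma total_gp_set_empty: "total_gp_set G {}"
  by (simp add: total_gp_set_def positionable_def)

lemma finite_total_gp_sets: "finite (pverts G) \<Longrightarrow> finite {X. total_gp_set G X}"
  by (rule finite_subset[of _ "Pow (pverts G)"]) (auto simp: total_gp_set_def)

end

(* For a vertex (g, h), let g' be a neighbour of g in G and h' a neighbour of h in H. Then (g', h)
   and (g, h') are distinct and nonadjacent, so the path (g', h), (g, h), (g, h') is a shortest path
   and its middle vertex lies in no total general position set. *)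

theory Submission
  imports Defs
begin

text \<open>A walk from \<open>u\<close> to some other vertex must begin with an arc leaving
  \<open>u\<close>.\<close>

lemma (in pair_graph) connected_imp_neighbour:
  assumes "connected (with_proj G)" "card (pverts G) \<ge> 2" "u \<in> pverts G"
  obtains w where "(u, w) \<in> parcs G"
proof -
  have "\<not> pverts G \<subseteq> {u}"
    using assms(2) card_mono[of "{u}" "pverts G"] by auto
  then obtain v where v: "v \<in> pverts G" "v \<noteq> u"
    by blast
  \<comment> \<open>\<open>connected\<close> refers to the symmetric closure of \<open>G\<close>.
    Since the arcs of \<open>G\<close> are already symmetric, reachability is the same in
    both.\<close>
  have "u \<rightarrow>\<^sup>*\<^bsub>mk_symmetric G\<^esub> v"
    using assms v by (auto simp: connected_def strongly_connected_def)
  then have "u \<rightarrow>\<^sup>*\<^bsub>with_proj G\<^esub> v"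
    using reachable_mk_symmetric_eq[OF pair_sym_arcs] by simp
  then show ?thesis
    using v that by (cases rule: converse_reachable_cases) auto
qed

text \<open>Nothing shorter is possible: a one-vertex path would force \<open>u = v\<close>, and a
  one-arc path would need the arc \<open>(u, v)\<close>.\<close>

lemma (in pair_loopfree_digraph) shortest_path_two_arcs:
  assumes "(u, w) \<in> parcs G" "(w, v) \<in> parcs G" "u \<noteq> v" "(u, v) \<notin> parcs G"
  shows "shortest_path G u [u, w, v] v"
proof -
  have "path_betw G u [u, w, v] v"
    using assms pair_no_loops[of "(u, w)"] pair_no_loops[of "(w, v)"]
    by (auto simp: path_betw_def vpath_def vwalk_def dest: in_arcsD1 in_arcsD2)
  moreover have "vwalk_length [u, w, v] \<le> vwalk_length q" if "path_betw G u q v" for q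
    using that assms
    \<comment> \<open>The first split is into zero, one or at least two vertices; whether
      \<open>tl (tl q)\<close> is empty then isolates the paths with exactly one arc.\<close>
    by (cases q rule: vwalk_arcs.cases; cases "tl (tl q)")
      (auto simp: path_betw_def vpath_def vwalk_def)
  ultimately show ?thesis
    by (simp add: shortest_path_def)
qed

lemma (in pair_loopfree_digraph) total_gp_set_avoids_middle:
  assumes "total_gp_set G X"
    and "(u, w) \<in> parcs G" "(w, v) \<in> parcs G" "u \<noteq> v" "(u, v) \<notin> parcs G"
  shows "w \<notin> X"
proof -
  have "positionable G X u v"
    using assms in_arcsD1[of u w] in_arcsD2[of w v] by (simp add: total_gp_set_def)
  then have "set [u, w, v] \<inter> X \<subseteq> {u, v}"
    using shortest_path_two_arcs[of u w v] assms by (simp only: positionable_def) blast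
  \<comment> \<open>Looplessness gives \<open>w \<noteq> u\<close> and \<open>w \<noteq> v\<close>,
    so \<open>w\<close> is not one of the exempted endpoints.\<close>
  then show ?thesis
    using assms pair_no_loops[of "(u, w)"] pair_no_loops[of "(w, v)"] by auto
qed

lemma total_gp_set_cart_prod:
  assumes "pair_graph G" "connected (with_proj G)" "card (pverts G) \<ge> 2"
    and "pair_graph H" "connected (with_proj H)" "card (pverts H) \<ge> 2"
    and X: "total_gp_set (G \<box> H) X"
  shows "X = {}"
proof -
  interpret G: pair_graph G by fact
  interpret H: pair_graph H by fact
  interpret P: pair_graph "G \<box> H"
    by (rule pair_graph_cart_prod) fact+
  have "(g, h) \<notin> X" if gh: "g \<in> pverts G" "h \<in> pverts H" for g h
  proof -
    obtain g' where "(g, g') \<in> parcs G"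
      using G.connected_imp_neighbour assms gh by metis
    then have g': "(g', g) \<in> parcs G" "g' \<noteq> g"
      using G.arcs_symmetric G.no_loops' by auto
    obtain h' where h': "(h, h') \<in> parcs H" "h' \<noteq> h"
      using H.connected_imp_neighbour H.no_loops' assms gh by metis
    show ?thesis
      \<comment> \<open>The endpoints differ in both coordinates, while every arc of the product
        keeps one coordinate fixed.\<close>
      by (rule P.total_gp_set_avoids_middle[OF X, of "(g', h)" _ "(g, h')"])
        (use g' h' gh in \<open>auto simp: cart_prod_def dest: G.in_arcsD1 H.in_arcsD2\<close>)
  qed
  moreover have "X \<subseteq> pverts G \<times> pverts H"
    using X by (auto simp: total_gp_set_def cart_prod_def)
  ultimately show ?thesis
    by auto
qed

theorem corollary4p1:
  fixes G :: "'a pair_pre_digraph" and H :: "'b pair_pre_digraph"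
  assumes "pair_graph G" and "Digraph_Component.connected (with_proj G)" and "card (pverts G) \<ge> 2"
    and "pair_graph H" and "Digraph_Component.connected (with_proj H)" and "card (pverts H) \<ge> 2"
  shows "gp_t (G \<box> H) = 0"
proof -
  \<comment> \<open>The empty set does qualify, so \<open>Max\<close> is taken over a singleton and
    not over the empty set.\<close>
  have "{X. total_gp_set (G \<box> H) X} = {{}}"
    using total_gp_set_cart_prod[OF assms] total_gp_set_empty by blast
  then show ?thesis
    by (simp add: gp_t_def)
qed

end
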